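(* Let $(X,d)$ be a complete metric space and let $T\colon X\to X$ be an additive-type contraction, i.e. there exist $\alpha\in[0,1)$ and a semimetric $\delta\colon X\times X\to[0,\infty)$ such that $$d(Tx,Ty)+\delta(Tx,Ty)\le \alpha\,\big(d(x,y)+\delta(x,y)\big)\quad\text{for all }x,y\in X.$$ If $T$ is continuous in $(X,d)$, then $T$ is a Picard operator on $(X,d)$.
   Context: $X$ is a nonempty set. A semimetric on $X$ is a map $\delta\colon X\times X\to[0,\infty)$ such that $\delta(x,y)=0$ if and only if $x=y$, and $\delta(x,y)=\delta(y,x)$ for all $x,y\in X$ (no triangle inequality is required). A self-mapping $T$ of a metric space $(X,d)$ is called a Picard operator if $T$ has a unique fixed point $u\in X$ and for every $x\in X$ the sequence of iterates $(T^n x)$ converges to $u$ in $(X,d)$. *)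

theory Defs
  imports "HOL-Analysis.Analysis"
begin

definition semimetric_on :: "'a set \<Rightarrow> ('a \<Rightarrow> 'a \<Rightarrow> real) \<Rightarrow> bool" where
  "semimetric_on X \<delta> \<longleftrightarrow>
     (\<forall>x\<in>X. \<forall>y\<in>X. 0 \<le> \<delta> x y \<and> (\<delta> x y = 0 \<longleftrightarrow> x = y) \<and> \<delta> x y = \<delta> y x)"

definition additive_type_contraction ::
    "'a set \<Rightarrow> ('a \<Rightarrow> 'a \<Rightarrow> real) \<Rightarrow> ('a \<Rightarrow> 'a) \<Rightarrow> bool" where
  "additive_type_contraction X d T \<longleftrightarrow>
     T \<in> X \<rightarrow> X \<and>
     (\<exists>(\<alpha>::real) \<delta>. 0 \<le> \<alpha> \<and> \<alpha> < 1 \<and> semimetric_on X \<delta> \<and>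
        (\<forall>x\<in>X. \<forall>y\<in>X. d (T x) (T y) + \<delta> (T x) (T y) \<le> \<alpha> * (d x y + \<delta> x y)))"

definition picard_operator ::
    "'a set \<Rightarrow> ('a \<Rightarrow> 'a \<Rightarrow> real) \<Rightarrow> ('a \<Rightarrow> 'a) \<Rightarrow> bool" where
  "picard_operator X d T \<longleftrightarrow>
     T \<in> X \<rightarrow> X \<and>
     (\<exists>u\<in>X. T u = u \<and> (\<forall>v\<in>X. T v = v \<longrightarrow> v = u) \<and>
        (\<forall>x\<in>X. limitin (Metric_space.mtopology X d) (\<lambda>n. (T ^^ n) x) u sequentially))"

end

theory Submission
  imports Defs
begin

text \<open>
  The sum \<open>d + \<delta>\<close> is contracted by \<open>T\<close>, so it decays geometrically along every orbit, and so does its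
  summand \<open>d\<close>. Hence every orbit is \<open>d\<close>-Cauchy, and by continuity its limit is a fixed point. Two fixed
  points have \<open>d + \<delta>\<close> distance zero, so all orbits share the same limit. The missing triangle
  inequality for \<open>\<delta>\<close> never matters.
\<close>

text \<open>Summing the steps with the triangle inequality bounds the distance from
  \<open>\<sigma> n\<close> to any later term by a geometric tail, which tends to 0.\<close>

lemma (in Metric_space) MCauchy_if_dist_Suc_le_geometric:
  assumes \<sigma>: "range \<sigma> \<subseteq> M" and \<alpha>: "0 \<le> \<alpha>" "\<alpha> < 1"
    and step: "\<And>n. d (\<sigma> n) (\<sigma> (Suc n)) \<le> C * \<alpha> ^ n"
  shows "MCauchy \<sigma>"
proof -
  \<comment> \<open>The case \<open>n = 0\<close> of \<open>step\<close> puts \<open>C\<close> above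
    a distance. The sign is what allows \<open>C * \<alpha> ^ m\<close> to be dropped in
    \<open>tail\<close>.\<close>
  have C: "0 \<le> C"
    using step[of 0] order_trans[OF nonneg] by fastforce
  \<comment> \<open>The factor \<open>1 - \<alpha>\<close> turns each summand
    \<open>C * \<alpha> ^ i\<close> into \<open>C * (\<alpha> ^ i - \<alpha> ^ Suc i)\<close>, so
    the sum collapses without any division.\<close>
  have telescope: "(1 - \<alpha>) * d (\<sigma> n) (\<sigma> (n + k)) \<le> C * (\<alpha> ^ n - \<alpha> ^ (n + k))" for n k
  proof (induction k)
    case 0
    then show ?case using \<sigma> by (simp add: range_subsetD)
  next
    case (Suc k)
    have "d (\<sigma> n) (\<sigma> (n + Suc k)) \<le> d (\<sigma> n) (\<sigma> (n + k)) + C * \<alpha> ^ (n + k)"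
      using triangle[of "\<sigma> n" "\<sigma> (n + k)" "\<sigma> (n + Suc k)"] step[of "n + k"] \<sigma>
      by (simp add: range_subsetD)
    then have "(1 - \<alpha>) * d (\<sigma> n) (\<sigma> (n + Suc k))
        \<le> (1 - \<alpha>) * (d (\<sigma> n) (\<sigma> (n + k)) + C * \<alpha> ^ (n + k))"
      using \<alpha> by (intro mult_left_mono) auto
    with Suc show ?case by (simp add: algebra_simps)
  qed
  have tail: "d (\<sigma> n) (\<sigma> m) \<le> C / (1 - \<alpha>) * \<alpha> ^ n" if "n \<le> m" for n m
  proof -
    have "(1 - \<alpha>) * d (\<sigma> n) (\<sigma> m) \<le> C * (\<alpha> ^ n - \<alpha> ^ m)"
      using telescope[of n "m - n"] that by simp
    also have "\<dots> \<le> C * \<alpha> ^ n"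
      using C \<alpha> by (intro mult_left_mono) auto
    finally show ?thesis
      using \<alpha> by (simp add: field_simps)
  qed
  have "(\<lambda>n. C / (1 - \<alpha>) * \<alpha> ^ n) \<longlonglongrightarrow> 0"
    using \<alpha> by (intro tendsto_mult_right_zero LIMSEQ_power_zero) auto
  then have small: "\<exists>N. \<forall>n\<ge>N. C / (1 - \<alpha>) * \<alpha> ^ n < \<epsilon>" if "\<epsilon> > 0" for \<epsilon>
    using order_tendstoD(2) that by (fastforce simp: eventually_sequentially)
  show ?thesis
    unfolding MCauchy_def
  proof (intro conjI allI impI \<sigma>)
    fix \<epsilon> :: real
    assume "\<epsilon> > 0"
    then obtain N where N: "\<And>n. n \<ge> N \<Longrightarrow> C / (1 - \<alpha>) * \<alpha> ^ n < \<epsilon>"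
      using small by blast
    have "d (\<sigma> n) (\<sigma> m) < \<epsilon>" if "N \<le> n" "N \<le> m" for n m
      using N that tail[of n m] tail[of m n] commute[of "\<sigma> n" "\<sigma> m"]
      by (cases "n \<le> m") (fastforce intro: le_less_trans)+
    then show "\<exists>N. \<forall>n n'. N \<le> n \<longrightarrow> N \<le> n' \<longrightarrow> d (\<sigma> n) (\<sigma> n') < \<epsilon>"
      by blast
  qed
qed

text \<open>The shifted orbit is the image of the orbit under \<open>T\<close>, so it tends to
  \<open>T u\<close> by continuity; as a tail of the orbit it also tends to \<open>u\<close>. Metric
  limits are unique.\<close>

lemma (in Metric_space) limit_of_iterates_fixed:
  assumes "continuous_map mtopology mtopology T"
    and lim: "limitin mtopology (\<lambda>n. (T ^^ n) x) u sequentially"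
  shows "T u = u"
proof -
  have "limitin mtopology (\<lambda>n. (T ^^ Suc n) x) (T u) sequentially"
    using continuous_map_limit[OF assms] by (simp add: o_def)
  moreover have "limitin mtopology (\<lambda>n. (T ^^ Suc n) x) u sequentially"
    using limitin_sequentially_offset[OF lim, of 1] by simp
  ultimately show ?thesis
    by (meson limitin_metric_unique trivial_limit_sequentially)
qed

theorem theorem3p2:
  fixes X :: "'a set" and d :: "'a \<Rightarrow> 'a \<Rightarrow> real" and T :: "'a \<Rightarrow> 'a"
  assumes "X \<noteq> {}"
    and "Metric_space X d"
    and "Metric_space.mcomplete X d"
    and "additive_type_contraction X d T"
    and "continuous_map (Metric_space.mtopology X d) (Metric_space.mtopology X d) T"
  shows "picard_operator X d T"
proof -
  interpret Metric_space X d by fact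
  obtain \<alpha> \<delta> where TX: "T \<in> X \<rightarrow> X" and \<alpha>: "0 \<le> \<alpha>" "\<alpha> < 1"
    and \<delta>: "semimetric_on X \<delta>"
    and contr: "\<And>x y. \<lbrakk>x \<in> X; y \<in> X\<rbrakk>
      \<Longrightarrow> d (T x) (T y) + \<delta> (T x) (T y) \<le> \<alpha> * (d x y + \<delta> x y)"
    using assms(4) unfolding additive_type_contraction_def by blast
  have \<delta>_nonneg: "0 \<le> \<delta> x y" if "x \<in> X" "y \<in> X" for x y
    using \<delta> that unfolding semimetric_on_def by blast
  have orbit: "(T ^^ n) x \<in> X" if "x \<in> X" for x n
    using TX that by (induction n) auto
  have unique: "u = v" if "u \<in> X" "v \<in> X" "T u = u" "T v = v" for u v
  proof -
    \<comment> \<open>At two fixed points the contraction reads \<open>s \<le> \<alpha> * s\<close>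
      with \<open>s = d u v + \<delta> u v\<close>.\<close>
    have "(1 - \<alpha>) * (d u v + \<delta> u v) \<le> 0"
      using contr[of u v] that by (simp add: algebra_simps)
    then have "d u v + \<delta> u v \<le> 0"
      using \<alpha> by (simp add: mult_le_0_iff)
    then show ?thesis
      using \<delta>_nonneg[of u v] nonneg[of u v] zero[of u v] that by linarith
  qed
  have conv: "\<exists>u\<in>X. T u = u \<and> limitin mtopology (\<lambda>n. (T ^^ n) x) u sequentially"
    if x: "x \<in> X" for x
  proof -
    define C where "C = d x (T x) + \<delta> x (T x)"
    let ?\<sigma> = "\<lambda>n. (T ^^ n) x"
    \<comment> \<open>The induction has to carry the whole sum, since the hypothesis bounds
      \<open>d\<close> after applying \<open>T\<close> only in terms of \<open>d + \<delta>\<close>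
      before.\<close>
    have decay: "d (?\<sigma> n) (?\<sigma> (Suc n)) + \<delta> (?\<sigma> n) (?\<sigma> (Suc n)) \<le> C * \<alpha> ^ n" for n
    proof (induction n)
      case 0
      then show ?case by (simp add: C_def)
    next
      case (Suc n)
      have "d (?\<sigma> (Suc n)) (?\<sigma> (Suc (Suc n))) + \<delta> (?\<sigma> (Suc n)) (?\<sigma> (Suc (Suc n)))
          \<le> \<alpha> * (d (?\<sigma> n) (?\<sigma> (Suc n)) + \<delta> (?\<sigma> n) (?\<sigma> (Suc n)))"
        using contr[OF orbit[OF x, of n] orbit[OF x, of "Suc n"]] by simp
      also have "\<dots> \<le> \<alpha> * (C * \<alpha> ^ n)"
        using Suc \<alpha> by (intro mult_left_mono) auto
      finally show ?case by (simp add: mult_ac)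
    qed
    have "d (?\<sigma> n) (?\<sigma> (Suc n)) \<le> C * \<alpha> ^ n" for n
      using decay[of n] \<delta>_nonneg[OF orbit[OF x, of n] orbit[OF x, of "Suc n"]] by linarith
    then have "MCauchy ?\<sigma>"
      using orbit[OF x] \<alpha> by (intro MCauchy_if_dist_Suc_le_geometric) auto
    then obtain u where u: "limitin mtopology ?\<sigma> u sequentially"
      using assms(3) unfolding mcomplete_def by blast
    then show ?thesis
      using limit_of_iterates_fixed[OF assms(5) u] limitin_mspace by blast
  qed
  then obtain u where u: "u \<in> X" "T u = u"
    using \<open>X \<noteq> {}\<close> by blast
  \<comment> \<open>The limit that \<open>conv\<close> gives for this \<open>x\<close> is itself a
    fixed point, hence equal to \<open>u\<close>.\<close>
  have "limitin mtopology (\<lambda>n. (T ^^ n) x) u sequentially" if "x \<in> X" for x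
    using conv[OF that] unique u by blast
  then show ?thesis
    using TX u unique unfolding picard_operator_def by blast
qed

end
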